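(* Let $(X,\mathrm{cl})$ be an $\omega$-homogeneous pregeometry. If $(X,\mathrm{cl})$ is non-trivial, then there exists a finite $A_0\subseteq X$ such that the localized pregeometry $(X,\mathrm{cl}_{A_0})$ is federated.
   Context: For a pregeometry $(X,\mathrm{cl})$ and $A_0\subseteq X$, the localization is $\mathrm{cl}_{A_0}(B)=\mathrm{cl}(A_0\cup B)$. $(X,\mathrm{cl})$ is trivial if $\mathrm{cl}(A)=\bigcup_{a\in A}\mathrm{cl}(\{a\})$ for every $A\subseteq X$. $(X,\mathrm{cl})$ is $\omega$-homogeneous if for every finite $A\subseteq X$ and $a,b\in X-\mathrm{cl}(A)$ there is an automorphism $f$ of $(X,\mathrm{cl})$ (a bijection of $X$ with $f(\mathrm{cl}(B))=\mathrm{cl}(f(B))$ for all $B$) fixing $A$ pointwise with $f(a)=b$. A pregeometry $(X,\mathrm{cl})$ is federated if for every finite independent $D_0\subseteq X$, $\mathrm{cl}(D_0)\neq\bigcup_{D\subsetneq D_0}\mathrm{cl}(D)$.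
   Formalization: "Trivial" is taken to require cl(A) = ⋃_{a∈A} cl({a}) only for nonempty A; with A = ∅ included, the claim fails for X infinite and cl(B) = B ∪ {l}, which would count as non-trivial merely because cl(∅) ≠ ∅. *)

theory Defs
  imports Main
begin

locale pregeometry =
  fixes X :: "'a set" and cl :: "'a set \<Rightarrow> 'a set"
  assumes cl_closed: "B \<subseteq> X \<Longrightarrow> cl B \<subseteq> X"
    and cl_extensive: "B \<subseteq> X \<Longrightarrow> B \<subseteq> cl B"
    and cl_mono: "\<lbrakk>B \<subseteq> C; C \<subseteq> X\<rbrakk> \<Longrightarrow> cl B \<subseteq> cl C"
    and cl_idem: "B \<subseteq> X \<Longrightarrow> cl (cl B) = cl B"
    and cl_finite_character: "\<lbrakk>B \<subseteq> X; a \<in> cl B\<rbrakk> \<Longrightarrow> \<exists>F. finite F \<and> F \<subseteq> B \<and> a \<in> cl F"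
    and cl_exchange: "\<lbrakk>B \<subseteq> X; a \<in> X; b \<in> X; a \<in> cl (insert b B); a \<notin> cl B\<rbrakk>
                        \<Longrightarrow> b \<in> cl (insert a B)"

definition localization :: "('a set \<Rightarrow> 'a set) \<Rightarrow> 'a set \<Rightarrow> 'a set \<Rightarrow> 'a set" where
  "localization cl A\<^sub>0 B = cl (A\<^sub>0 \<union> B)"

text \<open>
  The set \<open>A\<close> is required to be nonempty. For \<open>A = {}\<close> the equation would read \<open>cl {} = {}\<close>, so
  that every pregeometry with \<open>cl {} \<noteq> {}\<close> would count as non-trivial, even \<open>cl B = B \<union> {l}\<close>
  for a fixed \<open>l\<close>, no localization of which at a finite set is federated if \<open>X\<close> is infinite.
\<close>
definition trivial_pregeometry :: "'a set \<Rightarrow> ('a set \<Rightarrow> 'a set) \<Rightarrow> bool" where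
  "trivial_pregeometry X cl \<longleftrightarrow> (\<forall>A. A \<subseteq> X \<and> A \<noteq> {} \<longrightarrow> cl A = (\<Union>a\<in>A. cl {a}))"

definition pregeometry_automorphism ::
    "'a set \<Rightarrow> ('a set \<Rightarrow> 'a set) \<Rightarrow> ('a \<Rightarrow> 'a) \<Rightarrow> bool" where
  "pregeometry_automorphism X cl f \<longleftrightarrow>
     bij_betw f X X \<and> (\<forall>B. B \<subseteq> X \<longrightarrow> f ` cl B = cl (f ` B))"

definition omega_homogeneous :: "'a set \<Rightarrow> ('a set \<Rightarrow> 'a set) \<Rightarrow> bool" where
  "omega_homogeneous X cl \<longleftrightarrow>
     (\<forall>A a b. finite A \<and> A \<subseteq> X \<and> a \<in> X - cl A \<and> b \<in> X - cl A \<longrightarrow>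
        (\<exists>f. pregeometry_automorphism X cl f \<and> (\<forall>x\<in>A. f x = x) \<and> f a = b))"

definition cl_independent :: "('a set \<Rightarrow> 'a set) \<Rightarrow> 'a set \<Rightarrow> bool" where
  "cl_independent cl D \<longleftrightarrow> (\<forall>d\<in>D. d \<notin> cl (D - {d}))"

text \<open>
  The case \<open>D\<^sub>0 = {}\<close> is included; it says \<open>cl {} \<noteq> {}\<close>.
\<close>
definition federated :: "'a set \<Rightarrow> ('a set \<Rightarrow> 'a set) \<Rightarrow> bool" where
  "federated X cl \<longleftrightarrow>
     (\<forall>D\<^sub>0. finite D\<^sub>0 \<and> D\<^sub>0 \<subseteq> X \<and> cl_independent cl D\<^sub>0 \<longrightarrow> cl D\<^sub>0 \<noteq> (\<Union>D\<in>{D. D \<subset> D\<^sub>0}. cl D))"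

lemma (in pregeometry) pregeometry_localization:
  assumes "A\<^sub>0 \<subseteq> X"
  shows "pregeometry X (localization cl A\<^sub>0)"
proof (unfold_locales, unfold localization_def)
  fix B assume B: "B \<subseteq> X"
  then have AB: "A\<^sub>0 \<union> B \<subseteq> X" using assms by blast
  show "cl (A\<^sub>0 \<union> B) \<subseteq> X" using cl_closed[OF AB] .
  show "B \<subseteq> cl (A\<^sub>0 \<union> B)" using cl_extensive[OF AB] by blast
  have "A\<^sub>0 \<union> cl (A\<^sub>0 \<union> B) = cl (A\<^sub>0 \<union> B)" using cl_extensive[OF AB] by blast
  then show "cl (A\<^sub>0 \<union> cl (A\<^sub>0 \<union> B)) = cl (A\<^sub>0 \<union> B)" using cl_idem[OF AB] by simp
next
  fix B C assume "B \<subseteq> C" "C \<subseteq> X"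
  then show "cl (A\<^sub>0 \<union> B) \<subseteq> cl (A\<^sub>0 \<union> C)" using assms by (intro cl_mono) auto
next
  fix B a assume B: "B \<subseteq> X" and a: "a \<in> cl (A\<^sub>0 \<union> B)"
  have AB: "A\<^sub>0 \<union> B \<subseteq> X" using assms B by blast
  obtain F where F: "finite F" "F \<subseteq> A\<^sub>0 \<union> B" "a \<in> cl F"
    using cl_finite_character[OF AB a] by blast
  have "cl F \<subseteq> cl (A\<^sub>0 \<union> (F \<inter> B))" using F(2) assms B by (intro cl_mono) auto
  then show "\<exists>F. finite F \<and> F \<subseteq> B \<and> a \<in> cl (A\<^sub>0 \<union> F)"
    using F by (intro exI[of _ "F \<inter> B"]) auto
next
  fix B a b
  assume "B \<subseteq> X" "a \<in> X" "b \<in> X" "a \<in> cl (A\<^sub>0 \<union> insert b B)" "a \<notin> cl (A\<^sub>0 \<union> B)"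
  then show "b \<in> cl (A\<^sub>0 \<union> insert a B)"
    using cl_exchange[of "A\<^sub>0 \<union> B" a b] assms by simp
qed

end

theory Submission imports Defs begin

text \<open>
  Nontriviality gives a minimal finite set with a point \<open>c\<close> in its closure and at least two
  elements \<open>a\<close>, \<open>b\<close>; localizing at the other elements puts \<open>c\<close> on the line through \<open>a\<close> and \<open>b\<close>
  but on neither point. By homogeneity every independent pair has such a third point. If \<open>z'\<close> is
  in general position in the closure of an independent set \<open>D\<close>, then a third point of \<open>z'\<close> and a
  new element \<open>x\<close> is in general position in the closure of \<open>D \<union> {x}\<close>; so by induction the
  localization is federated, except that the empty set requires a point in the closure of the
  empty set. This is arranged by localizing at one more point, taken outside the line \<open>ab\<close>
  if possible; otherwise the localization at \<open>a\<close> has rank one.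
\<close>

context pregeometry
begin

lemma cl_least:
  assumes "A \<subseteq> cl B" "B \<subseteq> X"
  shows "cl A \<subseteq> cl B"
  using assms cl_mono[of A "cl B"] cl_closed cl_idem by auto

lemma cl_subsetD:
  assumes "B \<subseteq> C" "C \<subseteq> X" "a \<in> cl B"
  shows "a \<in> cl C"
  using assms cl_mono by blast

lemma cl_superset:
  assumes "B \<subseteq> X" "a \<in> B"
  shows "a \<in> cl B"
  using assms cl_extensive by blast

lemma general_position_point_exists:
  assumes third: "\<And>x y. x \<in> X - cl {} \<Longrightarrow> y \<in> X - cl {x} \<Longrightarrow>
                     \<exists>z\<in>cl {x, y}. z \<notin> cl {x} \<and> z \<notin> cl {y}"
    and "finite D" "D \<noteq> {}" "D \<subseteq> X" "cl_independent cl D"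
  shows "\<exists>z\<in>cl D. \<forall>d\<in>D. z \<notin> cl (D - {d})"
  using assms(2-5)
proof (induction D rule: finite_ne_induct)
  case (singleton d)
  then show ?case
    using cl_superset[of "{d}" d] by (auto simp: cl_independent_def)
next
  case (insert x D)
  have X: "x \<in> X" "D \<subseteq> X" using insert.prems by auto
  have indep: "cl_independent cl D"
    unfolding cl_independent_def
  proof
    fix d assume d: "d \<in> D"
    then have "d \<notin> cl (insert x D - {d})"
      using insert.prems by (auto simp: cl_independent_def)
    then show "d \<notin> cl (D - {d})"
      using cl_subsetD[of "D - {d}" "insert x D - {d}" d] X by auto
  qed
  have x: "x \<notin> cl D"
    using insert.prems insert.hyps by (auto simp: cl_independent_def)
  obtain z' where z': "z' \<in> cl D" "\<forall>d\<in>D. z' \<notin> cl (D - {d})"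
    using insert.IH X indep by blast
  have z'X: "z' \<in> X" using z' cl_closed X by blast
  \<comment> \<open>Nonemptiness of \<open>D\<close> is what makes \<open>z'\<close> avoid
    \<open>cl {}\<close>, so that \<open>third\<close> applies to the pair \<open>z'\<close>,
    \<open>x\<close>.\<close>
  have z'_cl0: "z' \<notin> cl {}"
  proof -
    obtain d where "d \<in> D" using insert.hyps by blast
    then show ?thesis using z'(2) cl_subsetD[of "{}" "D - {d}" z'] X by auto
  qed
  have x_z': "x \<notin> cl {z'}" using cl_least[of "{z'}" D] z' x X by auto
  obtain z where z: "z \<in> cl {z', x}" "z \<notin> cl {z'}" "z \<notin> cl {x}"
    using third[of z' x] z'X z'_cl0 x_z' X by blast
  have zX: "z \<in> X" using z cl_closed[of "{z', x}"] X z'X by auto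
  \<comment> \<open>By exchange, any two of \<open>z\<close>, \<open>z'\<close>, \<open>x\<close>
    have the remaining one in their closure.\<close>
  have x_zz': "x \<in> cl {z, z'}"
    using cl_exchange[of "{z'}" z x] z X z'X zX by (simp add: insert_commute)
  have z'_zx: "z' \<in> cl {z, x}"
    using cl_exchange[of "{x}" z z'] z X z'X zX by simp
  have "z \<in> cl (insert x D)"
  proof -
    have "{z', x} \<subseteq> cl (insert x D)"
      using z' X cl_superset[of "insert x D" x] cl_subsetD[of D "insert x D" z'] by auto
    then show ?thesis using cl_least[of "{z', x}" "insert x D"] z X by auto
  qed
  moreover have "z \<notin> cl (insert x D - {d})" if d: "d \<in> insert x D" for d
  proof
    assume a: "z \<in> cl (insert x D - {d})"
    show False
    proof (cases "d = x")
      case True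
      then have "z \<in> cl D" using a insert.hyps by simp
      then have "x \<in> cl D" using cl_least[of "{z, z'}" D] x_zz' z' X by auto
      then show False using x by simp
    next
      \<comment> \<open>Over \<open>D - {d}\<close>, the points \<open>z\<close> and
        \<open>x\<close> recover \<open>z'\<close>. As \<open>z'\<close> is not in
        \<open>cl (D - {d})\<close>, exchange puts \<open>x\<close> in the closure of
        \<open>z'\<close> and \<open>D - {d}\<close>, hence in \<open>cl D\<close>.\<close>
      case False
      let ?E = "D - {d}"
      have dD: "d \<in> D" and eq: "insert x D - {d} = insert x ?E" using d False by auto
      have E: "?E \<subseteq> X" using X by auto
      have "{z, x} \<subseteq> cl (insert x ?E)"
        using a eq cl_superset[of "insert x ?E" x] X E by auto
      then have "z' \<in> cl (insert x ?E)"
        using cl_least[of "{z, x}" "insert x ?E"] z'_zx X E by auto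
      then have "x \<in> cl (insert z' ?E)"
        using cl_exchange[of ?E z' x] E X z'X z'(2) dD by auto
      moreover have "insert z' ?E \<subseteq> cl D"
        using z' X cl_superset[of D] by auto
      ultimately show False using cl_least[of "insert z' ?E" D] x X by auto
    qed
  qed
  ultimately show ?case by blast
qed

lemma federated_if_third_points:
  assumes third: "\<And>x y. x \<in> X - cl {} \<Longrightarrow> y \<in> X - cl {x} \<Longrightarrow>
                     \<exists>z\<in>cl {x, y}. z \<notin> cl {x} \<and> z \<notin> cl {y}"
    and "cl {} \<noteq> {}"
  shows "federated X cl"
  unfolding federated_def
proof (intro allI impI)
  fix D assume D: "finite D \<and> D \<subseteq> X \<and> cl_independent cl D"
  show "cl D \<noteq> (\<Union>E\<in>{E. E \<subset> D}. cl E)"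
  proof (cases "D = {}")
    case True
    then show ?thesis using assms(2) by auto
  next
    case False
    obtain z where z: "z \<in> cl D" "\<forall>d\<in>D. z \<notin> cl (D - {d})"
      using general_position_point_exists[OF third] D False by blast
    have "z \<notin> cl E" if E: "E \<subset> D" for E
    proof -
      obtain d where "d \<in> D" "E \<subseteq> D - {d}" using E by blast
      then show ?thesis using z(2) cl_subsetD[of E "D - {d}" z] D by blast
    qed
    then show ?thesis using z(1) by blast
  qed
qed

text \<open>The localized closure of the empty set is \<open>cl A\<close>, so
  \<open>cl A \<noteq> {}\<close> is the instance of federation at the empty set.\<close>

lemma localization_federated_if_third_points:
  assumes "A \<subseteq> X" "cl A \<noteq> {}"
    and "\<And>x y. x \<in> X - cl A \<Longrightarrow> y \<in> X - cl (insert x A) \<Longrightarrow>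
           \<exists>z\<in>cl (insert x (insert y A)). z \<notin> cl (insert x A) \<and> z \<notin> cl (insert y A)"
  shows "federated X (localization cl A)"
proof -
  interpret loc: pregeometry X "localization cl A"
    using pregeometry_localization[OF assms(1)] .
  show ?thesis
    by (rule loc.federated_if_third_points) (use assms(2,3) in \<open>auto simp: localization_def\<close>)
qed

lemma automorphism_cl_iff:
  assumes "pregeometry_automorphism X cl f" "B \<subseteq> X" "u \<in> X"
  shows "f u \<in> cl (f ` B) \<longleftrightarrow> u \<in> cl B"
proof -
  have "f ` cl B = cl (f ` B)" "inj_on f X"
    using assms by (auto simp: pregeometry_automorphism_def bij_betw_def)
  then show ?thesis
    using cl_closed[OF assms(2)] assms(3) by (metis inj_on_image_mem_iff)
qed

lemma automorphism_in_carrier: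
  assumes "pregeometry_automorphism X cl f" "u \<in> X"
  shows "f u \<in> X"
  using assms by (auto simp: pregeometry_automorphism_def bij_betw_def)

text \<open>Homogeneity is used twice: \<open>f\<close> fixes \<open>A\<close> and moves
  \<open>a\<close> to \<open>x\<close>, then \<open>g\<close> fixes \<open>A\<close> and
  \<open>x\<close> and moves \<open>f b\<close> to \<open>y\<close>. The second step is possible
  because \<open>f\<close> carries \<open>b\<close> outside \<open>cl (insert x A)\<close>.
  Automorphisms respect closure, so \<open>g (f c)\<close> is the required point.\<close>

lemma third_point_transfer:
  assumes hom: "omega_homogeneous X cl" and A: "finite A" "A \<subseteq> X"
    and a: "a \<in> X - cl A" and b: "b \<in> X - cl (insert a A)"
    and c: "c \<in> cl (insert a (insert b A))" "c \<notin> cl (insert a A)" "c \<notin> cl (insert b A)"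
    and x: "x \<in> X - cl A" and y: "y \<in> X - cl (insert x A)"
  shows "\<exists>z\<in>cl (insert x (insert y A)). z \<notin> cl (insert x A) \<and> z \<notin> cl (insert y A)"
proof -
  have cX: "c \<in> X" using c(1) cl_closed[of "insert a (insert b A)"] a b A by auto
  obtain f where f: "pregeometry_automorphism X cl f" "\<forall>u\<in>A. f u = u" "f a = x"
    using hom A a x unfolding omega_homogeneous_def by blast
  have fA: "f ` A = A" using f(2) by auto
  note f_iff = automorphism_cl_iff[OF f(1)] and fX = automorphism_in_carrier[OF f(1)]
  have fb: "f b \<in> X - cl (insert x A)"
    using f_iff[of "insert a A" b] fX[of b] a b A f(3) fA by auto
  obtain g where g: "pregeometry_automorphism X cl g" "\<forall>u\<in>insert x A. g u = u" "g (f b) = y"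
    using hom A x y fb unfolding omega_homogeneous_def
    by (metis DiffD1 finite_insert insert_subset)
  have gA: "g ` A = A" "g x = x" using g(2) by auto
  note g_iff = automorphism_cl_iff[OF g(1)]
  have *: "g (f c) \<in> cl (g ` f ` B) \<longleftrightarrow> c \<in> cl B" if "B \<subseteq> X" for B
    using g_iff[of "f ` B" "f c"] f_iff[of B c] fX that cX by auto
  show ?thesis
    using *[of "insert a (insert b A)"] *[of "insert a A"] *[of "insert b A"]
      a b A c fA gA f(3) g(3) by (intro bexI[of _ "g (f c)"]) auto
qed

lemma nontrivial_third_point:
  assumes "\<not> trivial_pregeometry X cl"
  obtains A a b c where "finite A" "A \<subseteq> X" "a \<in> X - cl A" "b \<in> X - cl (insert a A)"
    "c \<in> cl (insert a (insert b A))" "c \<notin> cl (insert a A)" "c \<notin> cl (insert b A)"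
proof -
  obtain B where B: "B \<subseteq> X" "B \<noteq> {}" "cl B \<noteq> (\<Union>a\<in>B. cl {a})"
    using assms unfolding trivial_pregeometry_def by blast
  have "(\<Union>a\<in>B. cl {a}) \<subseteq> cl B" using B(1) cl_mono[of "{_}" B] by blast
  then obtain c where c: "c \<in> cl B" "\<forall>a\<in>B. c \<notin> cl {a}" using B(3) by blast
  obtain G where "finite G \<and> G \<subseteq> B \<and> c \<in> cl G"
    using cl_finite_character[OF B(1) c(1)] by blast
  \<comment> \<open>\<open>F\<close> has least cardinality among the finite subsets of
    \<open>B\<close> whose closure contains \<open>c\<close>.\<close>
  then obtain F where F: "finite F \<and> F \<subseteq> B \<and> c \<in> cl F"
    and min: "\<And>G. finite G \<and> G \<subseteq> B \<and> c \<in> cl G \<Longrightarrow> card F \<le> card G"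
    using ex_has_least_nat[of "\<lambda>F. finite F \<and> F \<subseteq> B \<and> c \<in> cl F" G card] by blast
  have FX: "F \<subseteq> X" using F B by blast
  have proper: "c \<notin> cl G" if "G \<subset> F" for G
    using min[of G] psubset_card_mono[of F G] that F by (meson finite_subset leD order_trans psubset_imp_subset)
  \<comment> \<open>Since \<open>B\<close> has an element \<open>u\<close>, having \<open>c\<close>
    in \<open>cl {}\<close> would put it in \<open>cl {u}\<close>.\<close>
  have "\<exists>a. a \<in> F"
  proof (rule ccontr)
    assume "\<nexists>a. a \<in> F"
    then have "c \<in> cl {}" using F by auto
    then show False using c(2) B(1,2) cl_subsetD[of "{}" "{_}" c] by blast
  qed
  then obtain a where a: "a \<in> F" ..
  have "F \<noteq> {a}" using F c(2) by auto
  then obtain b where b: "b \<in> F" "b \<noteq> a" using a by blast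
  define A where "A = F - {a, b}"
  have eq: "insert a A = F - {b}" "insert b A = F - {a}" "insert a (insert b A) = F"
    using a b by (auto simp: A_def)
  \<comment> \<open>Minimality makes \<open>F\<close> independent: dropping a redundant
    \<open>d\<close> would leave a proper subset with \<open>c\<close> still in its closure.\<close>
  have nin: "d \<notin> cl (F - {d})" if "d \<in> F" for d
  proof
    assume "d \<in> cl (F - {d})"
    then have "F \<subseteq> cl (F - {d})" using FX cl_superset[of "F - {d}"] by auto
    then have "c \<in> cl (F - {d})" using cl_least[of F "F - {d}"] F FX by blast
    then show False using proper[of "F - {d}"] that by blast
  qed
  show thesis
  proof (rule that)
    show "finite A" "A \<subseteq> X" using F FX by (auto simp: A_def)
    show "a \<in> X - cl A"
      using nin[OF a] a FX cl_subsetD[of A "F - {a}" a] by (auto simp: A_def)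
    show "b \<in> X - cl (insert a A)" using nin b FX eq by auto
    show "c \<in> cl (insert a (insert b A))" "c \<notin> cl (insert a A)" "c \<notin> cl (insert b A)"
      using eq F a b proper[of "F - {a}"] proper[of "F - {b}"] by auto
  qed
qed

end

theorem theorem3p13:
  fixes X :: "'a set" and cl :: "'a set \<Rightarrow> 'a set"
  assumes "pregeometry X cl"
    and "omega_homogeneous X cl"
    and "\<not> trivial_pregeometry X cl"
  shows "\<exists>A\<^sub>0. finite A\<^sub>0 \<and> A\<^sub>0 \<subseteq> X \<and> federated X (localization cl A\<^sub>0)"
proof -
  interpret pregeometry X cl by fact
  obtain A a b c where A: "finite A" "A \<subseteq> X"
    and a: "a \<in> X - cl A" and b: "b \<in> X - cl (insert a A)"
    and c: "c \<in> cl (insert a (insert b A))" "c \<notin> cl (insert a A)" "c \<notin> cl (insert b A)"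
    using nontrivial_third_point[OF assms(3)] .
  have abA: "insert a (insert b A) \<subseteq> X" using a b A by auto
  have cX: "c \<in> X" using c(1) cl_closed[OF abA] by auto
  \<comment> \<open>If \<open>cl A\<close> is nonempty, \<open>A\<close> itself serves. Otherwise a
    point must be added: some \<open>e\<close> that keeps \<open>a\<close>, \<open>b\<close>,
    \<open>c\<close> in the same position, or else \<open>a\<close>.\<close>
  consider "cl A \<noteq> {}" | e where "e \<in> X - cl (insert a (insert b A))"
    | "X \<subseteq> cl (insert a (insert b A))" by blast
  then show ?thesis
  proof cases
    case 1
    have "federated X (localization cl A)"
      using A 1 third_point_transfer[OF assms(2) A a b c]
      by (intro localization_federated_if_third_points)
    then show ?thesis using A by blast
  next
    case (2 e)
    let ?A = "insert e A"
    have e: "e \<in> X" "e \<notin> cl (insert a (insert b A))" using 2 by auto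
    \<comment> \<open>Adding \<open>e\<close> creates no new dependence inside the old closure: if
      \<open>u\<close> entered \<open>cl B\<close> only through \<open>e\<close>, exchange would put
      \<open>e\<close> in \<open>cl (insert u B)\<close>, which lies in that closure.\<close>
    have notin: "u \<notin> cl (insert e B)"
      if "B \<subseteq> insert a (insert b A)" "u \<in> cl (insert a (insert b A))" "u \<notin> cl B" for u B
    proof
      assume u: "u \<in> cl (insert e B)"
      have BX: "B \<subseteq> X" and uX: "u \<in> X" using that abA cl_closed[OF abA] by auto
      have "e \<in> cl (insert u B)" using cl_exchange[of B u e] u that(3) BX uX e(1) by blast
      moreover have "insert u B \<subseteq> cl (insert a (insert b A))"
        using that cl_extensive[OF abA] by blast
      ultimately show False using cl_least[OF _ abA] e(2) by blast
    qed
    have A': "finite ?A" "?A \<subseteq> X" using A e by auto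
    have in_cl: "a \<in> cl (insert a (insert b A))" "b \<in> cl (insert a (insert b A))"
      using cl_superset[OF abA] by auto
    have a': "a \<in> X - cl ?A" using notin[of A a] in_cl a by auto
    have b': "b \<in> X - cl (insert a ?A)"
      using notin[of "insert a A" b] in_cl b by (auto simp: insert_commute)
    have c': "c \<in> cl (insert a (insert b ?A))" "c \<notin> cl (insert a ?A)" "c \<notin> cl (insert b ?A)"
      using cl_subsetD[OF _ _ c(1), of "insert a (insert b ?A)"] abA e(1)
        notin[of "insert a A" c] notin[of "insert b A" c] c
      by (auto simp: insert_commute)
    have "cl ?A \<noteq> {}" using cl_superset[OF A'(2), of e] by auto
    then have "federated X (localization cl ?A)"
      using A' third_point_transfer[OF assms(2) A' a' b' c']
      by (intro localization_federated_if_third_points)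
    then show ?thesis using A' by blast
  next
    case 3
    let ?A = "insert a A"
    have A': "finite ?A" "?A \<subseteq> X" using A a by auto
    \<comment> \<open>Over \<open>insert a A\<close>, any \<open>x\<close> outside the closure
      exchanges with \<open>b\<close> and so spans \<open>X\<close>. No \<open>y\<close> remains
      outside, and the third-point condition holds vacuously.\<close>
    have "X \<subseteq> cl (insert x ?A)" if x: "x \<in> X - cl ?A" for x
    proof -
      have xA: "insert x ?A \<subseteq> X" using x A' by auto
      have "b \<in> cl (insert x ?A)"
        using cl_exchange[of ?A x b] x b A' 3 by (auto simp: insert_commute)
      then have "insert a (insert b A) \<subseteq> cl (insert x ?A)" using cl_extensive[OF xA] by auto
      then show ?thesis using cl_least[OF _ xA] 3 by blast
    qed
    moreover have "cl ?A \<noteq> {}" using cl_superset[OF A'(2), of a] by auto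
    ultimately have "federated X (localization cl ?A)"
      using A' by (intro localization_federated_if_third_points) blast+
    then show ?thesis using A' by blast
  qed
qed

end
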